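(* Let $A \in S^{n\times n}$, $a, x_0, b_1,\ldots,b_m \in \mathbb{R}^n$ and $\gamma,\alpha,\beta_1,\ldots,\beta_m \in \mathbb{R}$, and let $f(x)=x^TAx+a^Tx+\gamma$, $g_0(x)=\|x-x_0\|^2-\alpha$ and $g_i(x)=b_i^Tx-\beta_i$, $i=1,\ldots,m$, for $x \in \mathbb{R}^n$. Let $s={\rm dim}\,{\rm span}\{b_1,\ldots,b_m\}$ and suppose that $${\rm dim}\,{\rm Ker}(A-\lambda_{\min}(A)I_n) \ge s+1.$$ Then the set $$U(f,g_0,g_1,\ldots,g_m):=\{(f(x),g_0(x),g_1(x),\ldots,g_m(x)) : x\in\mathbb{R}^n\}+\mathbb{R}^{m+2}_+$$ is convex.
   Context: $S^{n\times n}$ is the space of real symmetric $n\times n$ matrices, $I_n$ is the identity matrix, $\lambda_{\min}(A)$ is the smallest eigenvalue of $A$, ${\rm Ker}(M)=\{d : Md=0\}$, $\|\cdot\|$ is the Euclidean norm, and $\mathbb{R}^{m+2}_+$ is the nonnegative orthant. The sum of sets is the Minkowski sum. *)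

theory Defs
  imports "HOL-Analysis.Analysis"
begin

definition eigenvalues :: "real^'n^'n \<Rightarrow> real set" where
  "eigenvalues A = {l. \<exists>v. v \<noteq> 0 \<and> A *v v = l *\<^sub>R v}"

(* Only used for symmetric A, where the set of real eigenvalues is finite and nonempty,
   so that Min is the actual minimum. *)
definition lambda_min :: "real^'n^'n \<Rightarrow> real" where
  "lambda_min A = Min (eigenvalues A)"

definition Ker :: "real^'n^'m \<Rightarrow> (real^'n) set" where
  "Ker M = {d. M *v d = 0}"

definition quad_fun :: "real^'n^'n \<Rightarrow> real^'n \<Rightarrow> real \<Rightarrow> real^'n \<Rightarrow> real" where
  "quad_fun A a \<gamma> x = x \<bullet> (A *v x) + a \<bullet> x + \<gamma>"

definition ball_fun :: "real^'n \<Rightarrow> real \<Rightarrow> real^'n \<Rightarrow> real" where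
  "ball_fun x0 \<alpha> x = (norm (x - x0))\<^sup>2 - \<alpha>"

definition lin_fun :: "real^'n \<Rightarrow> real \<Rightarrow> real^'n \<Rightarrow> real" where
  "lin_fun b \<beta> x = b \<bullet> x - \<beta>"

(* The space R^(m+2) is real^'k, where idx enumerates the index type 'k bijectively by
   0, ..., m+1 (hence CARD('k) = m+2): component idx 0 carries f, component idx 1 carries g0,
   and component idx (i+1) carries g i for i = 1, ..., m.  The case m = 0 is allowed. *)
definition joint_range ::
  "(nat \<Rightarrow> 'k::finite) \<Rightarrow> nat \<Rightarrow> ('a \<Rightarrow> real) \<Rightarrow> ('a \<Rightarrow> real) \<Rightarrow> (nat \<Rightarrow> 'a \<Rightarrow> real) \<Rightarrow> (real^'k) set" where
  "joint_range idx m f g0 g =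
     {y. \<exists>x. y $ idx 0 = f x \<and> y $ idx 1 = g0 x \<and> (\<forall>i\<in>{1..m}. y $ idx (i + 1) = g i x)}"

definition nonneg_orthant :: "(real^'k) set" where
  "nonneg_orthant = {r. \<forall>k. 0 \<le> r $ k}"

(* The sum of sets is the Minkowski sum of Set_Algebras. *)
definition U_set ::
  "(nat \<Rightarrow> 'k::finite) \<Rightarrow> nat \<Rightarrow> ('a \<Rightarrow> real) \<Rightarrow> ('a \<Rightarrow> real) \<Rightarrow> (nat \<Rightarrow> 'a \<Rightarrow> real) \<Rightarrow> (real^'k) set" where
  "U_set idx m f g0 g = joint_range idx m f g0 g + nonneg_orthant"

end

theory Submission
  imports Defs
begin

text \<open>
  With \<open>L = lambda_min A\<close> one has \<open>f = q + L * g0 + affine\<close>, where \<open>q x = x \<bullet> (A *v x) - L * (x \<bullet> x)\<close>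
  is a positive semidefinite form. Given two points and their convex combination \<open>z\<close>, the dimension
  condition yields a direction \<open>d \<noteq> 0\<close> in the \<open>L\<close>-eigenspace that is orthogonal to all \<open>b i\<close>. Moving
  from \<open>z\<close> along \<open>d\<close> changes neither \<open>q\<close> nor the \<open>g i\<close>; choosing the sign of \<open>d\<close> so that the affine
  part of \<open>f\<close> does not increase, one moves until \<open>g0\<close> equals the convex combination of
  its two values.
\<close>

section \<open>Spectral facts for real symmetric matrices\<close>

lemma symmetric_matrix_inner:
  fixes A :: "real^'n^'n"
  assumes "transpose A = A"
  shows "x \<bullet> (A *v y) = (A *v x) \<bullet> y"
  by (metis assms dot_lmul_matrix vector_transpose_matrix)

text \<open>Eigenvectors of distinct eigenvalues are orthogonal, so one eigenvector per eigenvalue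
  gives an independent, hence finite, family. Finiteness makes the \<open>Min\<close> in
  \<open>lambda_min\<close> a genuine lower bound.\<close>

lemma finite_eigenvalues_symmetric:
  fixes A :: "real^'n^'n"
  assumes sym: "transpose A = A"
  shows "finite (eigenvalues A)"
proof -
  define e where "e l = (SOME v. v \<noteq> 0 \<and> A *v v = l *\<^sub>R v)" for l
  have e: "e l \<noteq> 0 \<and> A *v e l = l *\<^sub>R e l" if "l \<in> eigenvalues A" for l
    unfolding e_def by (rule someI_ex) (use that in \<open>simp add: eigenvalues_def\<close>)
  have orth: "e l \<bullet> e k = 0" if "l \<in> eigenvalues A" "k \<in> eigenvalues A" "l \<noteq> k" for l k
  proof -
    have "k * (e l \<bullet> e k) = l * (e l \<bullet> e k)"
      using symmetric_matrix_inner[OF sym, of "e l" "e k"] e that by simp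
    then show ?thesis using that by simp
  qed
  have inj: "inj_on e (eigenvalues A)"
    by (intro inj_onI) (metis e inner_eq_zero_iff orth)
  have "pairwise orthogonal (e ` eigenvalues A)"
    unfolding pairwise_def orthogonal_def using orth by auto
  moreover have "0 \<notin> e ` eigenvalues A"
    using e by auto
  ultimately have "finite (e ` eigenvalues A)"
    using pairwise_orthogonal_independent independent_imp_finite by blast
  then show ?thesis using inj finite_imageD by blast
qed

lemma nonneg_quadratic_imp_linear_coeff_zero:
  fixes p c :: real
  assumes "\<And>t. 0 \<le> 2 * t * p + t\<^sup>2 * c"
  shows "p = 0"
proof (rule ccontr)
  assume p: "p \<noteq> 0"
  \<comment> \<open>The trial value is \<open>t = - p / k\<close>; since \<open>k\<close> exceeds
    both \<open>0\<close> and \<open>c\<close>, the factor \<open>c - 2 * k\<close> is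
    negative.\<close>
  define k where "k = \<bar>c\<bar> + 1"
  have k: "k > 0" "c < k" unfolding k_def by auto
  have "0 \<le> 2 * (- p / k) * p + (- p / k)\<^sup>2 * c" by (rule assms)
  also have "\<dots> = (p\<^sup>2 / k\<^sup>2) * (c - 2 * k)"
    using k by (simp add: field_simps power2_eq_square)
  also have "\<dots> < 0"
    using p k by (intro mult_pos_neg) auto
  finally show False by simp
qed

text \<open>The form attains a minimum on the compact unit sphere. Homogeneity extends the bound to
  all vectors, and first-order optimality makes the minimiser an eigenvector.\<close>

lemma symmetric_Rayleigh_min_eigenvalue:
  fixes A :: "real^'n^'n"
  assumes sym: "transpose A = A"
  obtains l where "l \<in> eigenvalues A" "\<And>x. l * (x \<bullet> x) \<le> x \<bullet> (A *v x)"
proof -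
  have "\<exists>v\<in>sphere 0 1. \<forall>w\<in>sphere 0 1. v \<bullet> (A *v v) \<le> w \<bullet> (A *v w)"
  proof (rule continuous_attains_inf)
    show "sphere (0::real^'n) 1 \<noteq> {}" by simp
    show "continuous_on (sphere 0 1) (\<lambda>v. v \<bullet> (A *v v))"
      by (intro continuous_intros matrix_vector_mult_linear_continuous_on)
  qed auto
  then obtain v where v: "norm v = 1"
    and min: "\<And>w. norm w = 1 \<Longrightarrow> v \<bullet> (A *v v) \<le> w \<bullet> (A *v w)"
    by auto
  define l where "l = v \<bullet> (A *v v)"
  define r where "r = A *v v - l *\<^sub>R v"
  have vv: "v \<bullet> v = 1" using v by (simp add: dot_square_norm)
  have l: "l * (x \<bullet> x) \<le> x \<bullet> (A *v x)" for x
  proof (cases "x = 0")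
    case False
    define y where "y = x /\<^sub>R norm x"
    have "x = norm x *\<^sub>R y" "norm y = 1"
      using False by (auto simp: y_def)
    then have "x \<bullet> (A *v x) = (norm x)\<^sup>2 * (y \<bullet> (A *v y))"
      by (metis (no_types, lifting) inner_scaleR_left inner_scaleR_right
          matrix_vector_mult_scaleR mult.assoc power2_eq_square)
    moreover have "l \<le> y \<bullet> (A *v y)"
      unfolding l_def using \<open>norm y = 1\<close> by (rule min)
    ultimately show ?thesis
      by (metis dot_square_norm mult.commute mult_right_mono zero_le_power2)
  qed simp
  \<comment> \<open>Perturb the minimiser \<open>v\<close> along its own residual \<open>r\<close>:
    the shifted form vanishes at \<open>v\<close> and is nonnegative everywhere, so its linear
    coefficient \<open>r \<bullet> r\<close> must vanish.\<close>
  have "0 \<le> 2 * t * (r \<bullet> r) + t\<^sup>2 * (r \<bullet> (A *v r) - l * (r \<bullet> r))" for t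
  proof -
    have 1: "r \<bullet> (A *v v) = r \<bullet> r + l * (r \<bullet> v)"
      by (simp add: r_def algebra_simps)
    have 2: "v \<bullet> (A *v r) = r \<bullet> (A *v v)"
      using symmetric_matrix_inner[OF sym, of v r] by (simp add: inner_commute)
    have "0 \<le> (v + t *\<^sub>R r) \<bullet> (A *v (v + t *\<^sub>R r)) - l * ((v + t *\<^sub>R r) \<bullet> (v + t *\<^sub>R r))"
      using l by simp
    also have "\<dots> = 2 * t * (r \<bullet> r) + t\<^sup>2 * (r \<bullet> (A *v r) - l * (r \<bullet> r))"
      by (simp add: matrix_vector_right_distrib matrix_vector_mult_scaleR inner_add_left
          inner_add_right 1 2 vv inner_commute[of v r] flip: l_def)
        (simp add: algebra_simps power2_eq_square)
    finally show ?thesis .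
  qed
  then have "r \<bullet> r = 0"
    by (rule nonneg_quadratic_imp_linear_coeff_zero)
  then have "A *v v = l *\<^sub>R v" by (simp add: r_def)
  then have "l \<in> eigenvalues A"
    unfolding eigenvalues_def using vv by (intro CollectI exI[of _ v]) auto
  with l that show ?thesis by blast
qed

lemma lambda_min_le_Rayleigh:
  fixes A :: "real^'n^'n"
  assumes sym: "transpose A = A"
  shows "lambda_min A * (x \<bullet> x) \<le> x \<bullet> (A *v x)"
proof -
  obtain l where l: "l \<in> eigenvalues A" "l * (x \<bullet> x) \<le> x \<bullet> (A *v x)"
    using symmetric_Rayleigh_min_eigenvalue[OF sym] by metis
  have "lambda_min A \<le> l"
    unfolding lambda_min_def using finite_eigenvalues_symmetric[OF sym] l by simp
  then have "lambda_min A * (x \<bullet> x) \<le> l * (x \<bullet> x)"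
    by (rule mult_right_mono) simp
  with l show ?thesis by simp
qed

section \<open>Choosing a direction and moving along it\<close>

lemma exists_nonzero_orthogonal_in_subspace:
  fixes K S :: "'a::euclidean_space set"
  assumes K: "subspace K" and dim: "dim S < dim K"
  obtains d where "d \<in> K" "d \<noteq> 0" "\<And>x. x \<in> S \<Longrightarrow> x \<bullet> d = 0"
proof -
  define T where "T = {y. \<forall>x\<in>span S. orthogonal x y}"
  have T: "subspace T"
    unfolding T_def by (rule subspace_orthogonal_to_vectors)
  have "dim T + dim (span S) = DIM('a)"
    using dim_subspace_orthogonal_to_vectors[of "span S" UNIV] by (simp add: T_def)
  moreover have "dim {x + y |x y. x \<in> K \<and> y \<in> T} + dim (K \<inter> T) = dim K + dim T"
    using K T by (rule dim_sums_Int)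
  moreover have "dim {x + y |x y. x \<in> K \<and> y \<in> T} \<le> DIM('a)"
    by (rule dim_subset_UNIV)
  \<comment> \<open>The complement \<open>T\<close> has codimension \<open>dim S < dim K\<close>, so
    the dimensions of \<open>K\<close> and \<open>T\<close> add up to more than that of the whole
    space.\<close>
  ultimately have "dim (K \<inter> T) \<noteq> 0"
    using dim unfolding dim_span by linarith
  then obtain d where "d \<in> K \<inter> T" "d \<noteq> 0"
    by (auto simp: dim_eq_0)
  then show ?thesis
    using that by (auto simp: T_def orthogonal_def span_base)
qed

lemma subspace_Ker: "subspace (Ker M)"
  by (auto simp: subspace_def Ker_def matrix_vector_right_distrib matrix_vector_mult_scaleR)

lemma Ker_shifted_iff: "d \<in> Ker (A - l *\<^sub>R mat 1) \<longleftrightarrow> A *v d = l *\<^sub>R d"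
  by (simp add: Ker_def matrix_vector_mult_diff_rdistrib flip: scaleR_matrix_vector_assoc)

lemma ray_meets_sphere:
  fixes u d :: "'a::real_normed_vector"
  assumes "norm u \<le> r" "d \<noteq> 0"
  obtains s where "s \<ge> 0" "norm (u + s *\<^sub>R d) = r"
proof -
  \<comment> \<open>This length makes \<open>norm (M *\<^sub>R d)\<close> equal to
    \<open>norm u + r\<close>, so the reverse triangle inequality puts the end of the segment
    outside the open ball and the intermediate value theorem applies.\<close>
  define M where "M = (norm u + r) / norm d"
  have r: "0 \<le> r" using assms(1) norm_ge_zero[of u] by linarith
  have M: "0 \<le> M" using r by (simp add: M_def)
  have "norm (M *\<^sub>R d) = norm u + r"
    using assms M by (simp add: M_def r)
  then have "r \<le> norm (u + M *\<^sub>R d)"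
    using norm_diff_ineq[of "M *\<^sub>R d" u] by (simp add: add.commute)
  moreover have "norm (u + 0 *\<^sub>R d) \<le> r" using assms by simp
  ultimately have "\<exists>s\<ge>0. s \<le> M \<and> norm (u + s *\<^sub>R d) = r"
    using M by (intro IVT') (auto intro!: continuous_intros)
  then show ?thesis using that by blast
qed

section \<open>Quadratic functions at convex combinations\<close>

lemma inner_self_convex_combination:
  fixes x y :: "'a::real_inner"
  assumes "u + v = (1::real)"
  shows "(u *\<^sub>R x + v *\<^sub>R y) \<bullet> (u *\<^sub>R x + v *\<^sub>R y)
    = u * (x \<bullet> x) + v * (y \<bullet> y) - u * v * ((x - y) \<bullet> (x - y))"
proof -
  have v: "v = 1 - u" using assms by simp
  show ?thesis
    unfolding v by (simp add: inner_add_left inner_add_right inner_diff_left inner_diff_right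
        inner_commute[of y x]) (simp add: algebra_simps)
qed

text \<open>An identity is needed because \<open>A\<close> may be indefinite: the defect term gets a
  sign only after the multiple \<open>lambda_min A\<close> of the inner product is
  subtracted.\<close>

lemma quadratic_form_convex_combination:
  fixes A :: "real^'n^'n"
  assumes sym: "transpose A = A" and "u + v = 1"
  shows "(u *\<^sub>R x + v *\<^sub>R y) \<bullet> (A *v (u *\<^sub>R x + v *\<^sub>R y))
    = u * (x \<bullet> (A *v x)) + v * (y \<bullet> (A *v y)) - u * v * ((x - y) \<bullet> (A *v (x - y)))"
proof -
  have v: "v = 1 - u" using assms by simp
  have c: "y \<bullet> (A *v x) = x \<bullet> (A *v y)"
    using symmetric_matrix_inner[OF sym, of x y] by (simp add: inner_commute)
  show ?thesis
    unfolding v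
    by (simp add: matrix_vector_right_distrib matrix_vector_mult_diff_distrib
        matrix_vector_mult_scaleR inner_add_left inner_add_right inner_diff_left inner_diff_right c)
      (simp add: algebra_simps)
qed

text \<open>The ball function must be matched exactly: the quadratic function contains it with
  factor \<open>lambda_min A\<close>, which may have either sign, so a one-sided estimate would not
  suffice.\<close>

lemma quad_ball_lin_convexlike:
  fixes A :: "real^'n^'n" and a x0 x1 x2 :: "real^'n" and S :: "(real^'n) set"
  assumes sym: "transpose A = A"
    and dim: "dim S < dim (Ker (A - lambda_min A *\<^sub>R mat 1))"
    and uv: "0 \<le> u" "0 \<le> v" "u + v = 1"
  obtains x where
    "quad_fun A a \<gamma> x \<le> u * quad_fun A a \<gamma> x1 + v * quad_fun A a \<gamma> x2"
    "ball_fun x0 \<alpha> x = u * ball_fun x0 \<alpha> x1 + v * ball_fun x0 \<alpha> x2"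
    "\<And>c. c \<in> S \<Longrightarrow> c \<bullet> x = u * (c \<bullet> x1) + v * (c \<bullet> x2)"
proof -
  have v: "v = 1 - u" using uv(3) by simp
  define L where "L = lambda_min A"
  \<comment> \<open>The linear coefficient that remains once \<open>q\<close> and \<open>L\<close>
    times the ball function are split off.\<close>
  define c where "c = a + (2 * L) *\<^sub>R x0"
  define z where "z = u *\<^sub>R x1 + v *\<^sub>R x2"
  define q where "q x = x \<bullet> (A *v x) - L * (x \<bullet> x)" for x
  obtain d where d: "A *v d = L *\<^sub>R d" "d \<noteq> 0" "\<And>x. x \<in> S \<Longrightarrow> x \<bullet> d = 0" "c \<bullet> d \<le> 0"
  proof -
    obtain d where d: "d \<in> Ker (A - L *\<^sub>R mat 1)" "d \<noteq> 0" "\<And>x. x \<in> S \<Longrightarrow> x \<bullet> d = 0"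
      using exists_nonzero_orthogonal_in_subspace[OF subspace_Ker dim] unfolding L_def by blast
    then have d1: "A *v d = L *\<^sub>R d" by (simp add: Ker_shifted_iff)
    show ?thesis
    proof (cases "c \<bullet> d \<le> 0")
      case True
      then show ?thesis using that d d1 by blast
    next
      case False
      have "A *v (- d) = L *\<^sub>R (- d)"
        using d1 matrix_vector_mult_scaleR[of A "-1" d] by simp
      then show ?thesis using that[of "- d"] d False by simp
    qed
  qed
  define R where "R = u * ((x1 - x0) \<bullet> (x1 - x0)) + v * ((x2 - x0) \<bullet> (x2 - x0))"
  have R: "0 \<le> R" unfolding R_def using uv by simp
  have z0: "z - x0 = u *\<^sub>R (x1 - x0) + v *\<^sub>R (x2 - x0)"
  proof -
    have "u *\<^sub>R x0 + v *\<^sub>R x0 = x0"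
      using uv(3) by (metis scaleR_add_left scaleR_one)
    then show ?thesis by (simp add: z_def algebra_simps)
  qed
  \<comment> \<open>Convexity of the squared norm: \<open>z\<close> lies inside the target sphere of
    squared radius \<open>R\<close>, so a ray from it meets that sphere.\<close>
  have "(z - x0) \<bullet> (z - x0) \<le> R"
    unfolding z0 inner_self_convex_combination[OF uv(3)] R_def using uv by simp
  then have "norm (z - x0) \<le> sqrt R"
    unfolding norm_eq_sqrt_inner by simp
  then obtain s where s: "s \<ge> 0" "norm (z - x0 + s *\<^sub>R d) = sqrt R"
    using ray_meets_sphere d(2) by blast
  define x where "x = z + s *\<^sub>R d"
  have "(norm (x - x0))\<^sup>2 = R"
    using s R by (simp add: x_def algebra_simps)
  then have ball: "ball_fun x0 \<alpha> x = u * ball_fun x0 \<alpha> x1 + v * ball_fun x0 \<alpha> x2"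
    unfolding ball_fun_def R_def dot_square_norm v by (simp add: algebra_simps)
  have f: "quad_fun A a \<gamma> y = q y + L * ball_fun x0 \<alpha> y + c \<bullet> y + (\<gamma> + L * \<alpha> - L * (x0 \<bullet> x0))" for y
    unfolding quad_fun_def q_def ball_fun_def c_def
    by (simp add: inner_add_left inner_diff_left inner_diff_right inner_commute[of y x0]
        flip: dot_square_norm) (simp add: algebra_simps)
  \<comment> \<open>Since \<open>d\<close> is an eigenvector for \<open>L\<close>, the terms of
    first and second order in \<open>s\<close> both cancel.\<close>
  have qx: "q x = q z"
    unfolding q_def x_def using d(1) symmetric_matrix_inner[OF sym, of d z]
    by (simp add: matrix_vector_right_distrib matrix_vector_mult_scaleR inner_add_left
        inner_add_right) (simp add: algebra_simps inner_commute)
  have "0 \<le> q (x1 - x2)"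
    unfolding q_def L_def using lambda_min_le_Rayleigh[OF sym] by simp
  then have "0 \<le> u * v * q (x1 - x2)" using uv by simp
  moreover have "q z = u * q x1 + v * q x2 - u * v * q (x1 - x2)"
    unfolding q_def z_def quadratic_form_convex_combination[OF sym uv(3)]
      inner_self_convex_combination[OF uv(3)] by (simp add: algebra_simps)
  ultimately have "q x \<le> u * q x1 + v * q x2" using qx by simp
  moreover have "c \<bullet> x \<le> u * (c \<bullet> x1) + v * (c \<bullet> x2)"
    unfolding x_def z_def using s d(4) by (simp add: inner_add_right mult_nonneg_nonpos)
  ultimately have quad: "quad_fun A a \<gamma> x \<le> u * quad_fun A a \<gamma> x1 + v * quad_fun A a \<gamma> x2"
    unfolding f ball v by (simp add: algebra_simps)
  have "e \<bullet> x = u * (e \<bullet> x1) + v * (e \<bullet> x2)" if "e \<in> S" for e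
    unfolding x_def z_def using d(3)[OF that] by (simp add: inner_add_right)
  with quad ball that show ?thesis by blast
qed

section \<open>The Minkowski sum as a system of inequalities, and convexity\<close>

lemma mem_U_set_iff:
  assumes bij: "bij_betw idx {0..m+1} (UNIV :: 'k::finite set)"
  shows "y \<in> U_set idx m f g0 g \<longleftrightarrow>
    (\<exists>x. f x \<le> y $ idx 0 \<and> g0 x \<le> y $ idx 1 \<and> (\<forall>i\<in>{1..m}. g i x \<le> y $ idx (i + 1)))"
    (is "_ \<longleftrightarrow> ?R")
proof
  assume "y \<in> U_set idx m f g0 g"
  then show ?R
    unfolding U_set_def joint_range_def nonneg_orthant_def
    by (elim set_plus_elim) (auto, metis le_add_same_cancel1)
next
  assume ?R
  then obtain x where x: "f x \<le> y $ idx 0" "g0 x \<le> y $ idx 1"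
      "\<And>i. i \<in> {1..m} \<Longrightarrow> g i x \<le> y $ idx (i + 1)"
    by blast
  \<comment> \<open>The point of the joint range at \<open>x\<close>, listed by position;
    \<open>i - 1\<close> undoes the shift of the linear components, and \<open>w\<close> carries the
    list to the index type through the inverse of \<open>idx\<close>.\<close>
  define h where "h i = (if i = 0 then f x else if i = 1 then g0 x else g (i - 1) x)" for i
  define w :: "real^'k" where "w = (\<chi> k. h (inv_into {0..m+1} idx k))"
  have w: "w $ idx i = h i" if "i \<le> m + 1" for i
    using that bij by (simp add: w_def bij_betw_def inv_into_f_f)
  have "w \<in> joint_range idx m f g0 g"
    unfolding joint_range_def by (auto simp: w h_def intro!: exI[of _ x])
  moreover have "y - w \<in> nonneg_orthant"
    unfolding nonneg_orthant_def
  proof (intro CollectI allI)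
    fix k
    obtain i where i: "i \<le> m + 1" "k = idx i"
      using bij by (metis UNIV_I atLeastAtMost_iff bij_betw_def imageE)
    consider "i = 0" | "i = 1" | "i - 1 \<in> {1..m}" "i = (i - 1) + 1" "i \<noteq> 0" "i \<noteq> 1"
      using i(1) by fastforce
    then have "h i \<le> y $ idx i"
      by cases (use x(1,2) x(3)[of "i - 1"] in \<open>auto simp: h_def\<close>)
    then show "0 \<le> (y - w) $ k" using i w by simp
  qed
  ultimately have "w + (y - w) \<in> U_set idx m f g0 g"
    unfolding U_set_def by (rule set_plus_intro)
  then show "y \<in> U_set idx m f g0 g" by simp
qed

theorem theorem2p1:
  fixes A :: "real^'n^'n"
    and a x0 :: "real^'n"
    and \<gamma> \<alpha> :: real
    and m :: nat
    and b :: "nat \<Rightarrow> real^'n"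
    and \<beta> :: "nat \<Rightarrow> real"
    and idx :: "nat \<Rightarrow> 'k::finite"
  assumes "transpose A = A"
    and "bij_betw idx {0..m+1} UNIV"
    and "dim (Ker (A - lambda_min A *\<^sub>R mat 1)) \<ge> dim (span (b ` {1..m})) + 1"
  shows "convex (U_set idx m (quad_fun A a \<gamma>) (ball_fun x0 \<alpha>) (\<lambda>i. lin_fun (b i) (\<beta> i)))"
proof (rule convexI)
  let ?q = "quad_fun A a \<gamma>" and ?ball = "ball_fun x0 \<alpha>" and ?g = "\<lambda>i. lin_fun (b i) (\<beta> i)"
  let ?U = "U_set idx m ?q ?ball ?g"
  fix y1 y2 and u v :: real
  assume y1: "y1 \<in> ?U" and y2: "y2 \<in> ?U" and uv: "0 \<le> u" "0 \<le> v" "u + v = 1"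
  obtain x1 where x1: "?q x1 \<le> y1 $ idx 0" "?ball x1 \<le> y1 $ idx 1"
      "\<And>i. i \<in> {1..m} \<Longrightarrow> ?g i x1 \<le> y1 $ idx (i + 1)"
    using y1 unfolding mem_U_set_iff[OF assms(2)] by blast
  obtain x2 where x2: "?q x2 \<le> y2 $ idx 0" "?ball x2 \<le> y2 $ idx 1"
      "\<And>i. i \<in> {1..m} \<Longrightarrow> ?g i x2 \<le> y2 $ idx (i + 1)"
    using y2 unfolding mem_U_set_iff[OF assms(2)] by blast
  have "dim (b ` {1..m}) < dim (Ker (A - lambda_min A *\<^sub>R mat 1))"
    using assms(3) by simp
  then obtain x where x: "?q x \<le> u * ?q x1 + v * ?q x2" "?ball x = u * ?ball x1 + v * ?ball x2"
      "\<And>c. c \<in> b ` {1..m} \<Longrightarrow> c \<bullet> x = u * (c \<bullet> x1) + v * (c \<bullet> x2)"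
    using quad_ball_lin_convexlike[OF assms(1) _ uv] by blast
  have mono: "u * p1 + v * p2 \<le> u * r1 + v * r2" if "p1 \<le> r1" "p2 \<le> r2" for p1 p2 r1 r2
    using that uv by (intro add_mono mult_left_mono)
  have g: "?g i x = u * ?g i x1 + v * ?g i x2" if "i \<in> {1..m}" for i
  proof -
    \<comment> \<open>The constant of an affine function is preserved because the weights sum to
      one.\<close>
    have "\<beta> i = u * \<beta> i + v * \<beta> i" using uv(3) by (metis distrib_right mult_1)
    then show ?thesis using x(3)[of "b i"] that by (simp add: lin_fun_def right_diff_distrib)
  qed
  have "?q x \<le> (u *\<^sub>R y1 + v *\<^sub>R y2) $ idx 0"
    using x(1) mono[OF x1(1) x2(1)] by simp
  moreover have "?ball x \<le> (u *\<^sub>R y1 + v *\<^sub>R y2) $ idx 1"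
    using x(2) mono[OF x1(2) x2(2)] by simp
  moreover have "?g i x \<le> (u *\<^sub>R y1 + v *\<^sub>R y2) $ idx (i + 1)" if "i \<in> {1..m}" for i
    using g[OF that] mono[OF x1(3)[OF that] x2(3)[OF that]] by simp
  ultimately show "u *\<^sub>R y1 + v *\<^sub>R y2 \<in> ?U"
    unfolding mem_U_set_iff[OF assms(2)] by blast
qed

end
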